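(* Let $H$ be a subgroup of a finite group $G$ such that the ring extension $\mathbb{C}G \,|\, \mathbb{C}H$ of complex group algebras is a depth two ring extension. Then $H$ is normal in $G$.
   Context: A ring extension $A\,|\,B$ is a unital ring homomorphism $B\to A$ (here the inclusion $\mathbb{C}H\subseteq\mathbb{C}G$); $A$ is regarded as a $B$-bimodule via this homomorphism. $M\oplus *\cong N$ means that $M$ is isomorphic to a direct summand of $N$. The extension $A\,|\,B$ is left depth two if there is a positive integer $n$ with $A\otimes_B A\oplus *\cong A^n$ as natural $B$-$A$-bimodules, right depth two if the same holds as natural $A$-$B$-bimodules, and depth two if it is both left and right depth two. *)

theory Defs
  imports Complex_Main "HOL-Algebra.Free_Abelian_Groups" "HOL-Algebra.RingHom"
begin

section \<open>Bimodules\<close>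

text \<open>
  Ring elements act by \<open>lsmult\<close> on the left and by \<open>rsmult\<close> on the right. As for the library's
  \<open>module\<close> record, the multiplicative fields inherited from \<open>ring\<close> carry no meaning.
\<close>

record ('r, 's, 'm) bimodule = "'m ring" +
  lsmult :: "'r \<Rightarrow> 'm \<Rightarrow> 'm"
  rsmult :: "'m \<Rightarrow> 's \<Rightarrow> 'm"

locale bimodule = R?: ring R + S?: ring S + M?: abelian_group M
  for R :: "('r, 'a) ring_scheme" and S :: "('s, 'b) ring_scheme"
    and M :: "('r, 's, 'm, 'c) bimodule_scheme" +
  assumes lsmult_closed: "\<lbrakk>r \<in> carrier R; x \<in> carrier M\<rbrakk> \<Longrightarrow> lsmult M r x \<in> carrier M"
    and rsmult_closed: "\<lbrakk>s \<in> carrier S; x \<in> carrier M\<rbrakk> \<Longrightarrow> rsmult M x s \<in> carrier M"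
    and lsmult_distrib_ring: "\<lbrakk>r \<in> carrier R; r' \<in> carrier R; x \<in> carrier M\<rbrakk> \<Longrightarrow>
      lsmult M (r \<oplus>\<^bsub>R\<^esub> r') x = lsmult M r x \<oplus>\<^bsub>M\<^esub> lsmult M r' x"
    and rsmult_distrib_ring: "\<lbrakk>s \<in> carrier S; s' \<in> carrier S; x \<in> carrier M\<rbrakk> \<Longrightarrow>
      rsmult M x (s \<oplus>\<^bsub>S\<^esub> s') = rsmult M x s \<oplus>\<^bsub>M\<^esub> rsmult M x s'"
    and lsmult_distrib: "\<lbrakk>r \<in> carrier R; x \<in> carrier M; y \<in> carrier M\<rbrakk> \<Longrightarrow>
      lsmult M r (x \<oplus>\<^bsub>M\<^esub> y) = lsmult M r x \<oplus>\<^bsub>M\<^esub> lsmult M r y"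
    and rsmult_distrib: "\<lbrakk>s \<in> carrier S; x \<in> carrier M; y \<in> carrier M\<rbrakk> \<Longrightarrow>
      rsmult M (x \<oplus>\<^bsub>M\<^esub> y) s = rsmult M x s \<oplus>\<^bsub>M\<^esub> rsmult M y s"
    and lsmult_assoc: "\<lbrakk>r \<in> carrier R; r' \<in> carrier R; x \<in> carrier M\<rbrakk> \<Longrightarrow>
      lsmult M (r \<otimes>\<^bsub>R\<^esub> r') x = lsmult M r (lsmult M r' x)"
    and rsmult_assoc: "\<lbrakk>s \<in> carrier S; s' \<in> carrier S; x \<in> carrier M\<rbrakk> \<Longrightarrow>
      rsmult M x (s \<otimes>\<^bsub>S\<^esub> s') = rsmult M (rsmult M x s) s'"
    and lsmult_one: "x \<in> carrier M \<Longrightarrow> lsmult M \<one>\<^bsub>R\<^esub> x = x"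
    and rsmult_one: "x \<in> carrier M \<Longrightarrow> rsmult M x \<one>\<^bsub>S\<^esub> = x"
    and smult_commute: "\<lbrakk>r \<in> carrier R; s \<in> carrier S; x \<in> carrier M\<rbrakk> \<Longrightarrow>
      rsmult M (lsmult M r x) s = lsmult M r (rsmult M x s)"

definition bimodule_iso ::
  "('r, 'a) ring_scheme \<Rightarrow> ('s, 'b) ring_scheme \<Rightarrow> ('r, 's, 'm, 'c) bimodule_scheme \<Rightarrow>
    ('r, 's, 'n, 'd) bimodule_scheme \<Rightarrow> ('m \<Rightarrow> 'n) set" where
  "bimodule_iso R S M N =
    {h \<in> iso (add_monoid M) (add_monoid N).
      (\<forall>r \<in> carrier R. \<forall>x \<in> carrier M. h (lsmult M r x) = lsmult N r (h x)) \<and>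
      (\<forall>s \<in> carrier S. \<forall>x \<in> carrier M. h (rsmult M x s) = rsmult N (h x) s)}"

definition subbimodule ::
  "('r, 'a) ring_scheme \<Rightarrow> ('s, 'b) ring_scheme \<Rightarrow> 'm set \<Rightarrow>
    ('r, 's, 'm, 'c) bimodule_scheme \<Rightarrow> bool" where
  "subbimodule R S U M \<longleftrightarrow> subgroup U (add_monoid M) \<and>
    (\<forall>r \<in> carrier R. \<forall>x \<in> U. lsmult M r x \<in> U) \<and>
    (\<forall>s \<in> carrier S. \<forall>x \<in> U. rsmult M x s \<in> U)"

definition direct_summand ::
  "('r, 'a) ring_scheme \<Rightarrow> ('s, 'b) ring_scheme \<Rightarrow> 'm set \<Rightarrow>
    ('r, 's, 'm, 'c) bimodule_scheme \<Rightarrow> bool" where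
  "direct_summand R S U M \<longleftrightarrow> subbimodule R S U M \<and>
    (\<exists>V. subbimodule R S V M \<and> U \<inter> V = {\<zero>\<^bsub>M\<^esub>} \<and> U <+>\<^bsub>M\<^esub> V = carrier M)"

text \<open>The relation \<open>M \<oplus> * \<cong> N\<close>.\<close>

definition iso_to_direct_summand ::
  "('r, 'a) ring_scheme \<Rightarrow> ('s, 'b) ring_scheme \<Rightarrow> ('r, 's, 'm, 'c) bimodule_scheme \<Rightarrow>
    ('r, 's, 'n, 'd) bimodule_scheme \<Rightarrow> bool" where
  "iso_to_direct_summand R S M N \<longleftrightarrow>
    (\<exists>U. direct_summand R S U N \<and> bimodule_iso R S M (N\<lparr>carrier := U\<rparr>) \<noteq> {})"

definition bimodule_power ::
  "('r, 's, 'm, 'c) bimodule_scheme \<Rightarrow> nat \<Rightarrow> ('r, 's, nat \<Rightarrow> 'm) bimodule" where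
  "bimodule_power M n =
    \<lparr>carrier = {..<n} \<rightarrow>\<^sub>E carrier M, monoid.mult = undefined, one = undefined,
     ring.zero = (\<lambda>i\<in>{..<n}. \<zero>\<^bsub>M\<^esub>), add = (\<lambda>x y. \<lambda>i\<in>{..<n}. x i \<oplus>\<^bsub>M\<^esub> y i),
     lsmult = (\<lambda>r x. \<lambda>i\<in>{..<n}. lsmult M r (x i)),
     rsmult = (\<lambda>x s. \<lambda>i\<in>{..<n}. rsmult M (x i) s)\<rparr>"

text \<open>A ring \<open>A\<close> as a bimodule via ring homomorphisms \<open>f : R \<rightarrow> A\<close> and \<open>g : S \<rightarrow> A\<close>.\<close>

definition ring_bimodule ::
  "('r \<Rightarrow> 'm) \<Rightarrow> ('s \<Rightarrow> 'm) \<Rightarrow> ('m, 'a) ring_scheme \<Rightarrow> ('r, 's, 'm) bimodule" where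
  "ring_bimodule f g A =
    \<lparr>carrier = carrier A, monoid.mult = undefined, one = undefined,
     ring.zero = \<zero>\<^bsub>A\<^esub>, add = (\<oplus>\<^bsub>A\<^esub>),
     lsmult = (\<lambda>r x. f r \<otimes>\<^bsub>A\<^esub> x), rsmult = (\<lambda>x s. x \<otimes>\<^bsub>A\<^esub> g s)\<rparr>"


section \<open>Tensor products\<close>

text \<open>
  For an \<open>R\<close>-\<open>S\<close>-bimodule \<open>M\<close> and an \<open>S\<close>-\<open>T\<close>-bimodule \<open>N\<close>, the tensor product over \<open>S\<close> is the
  free abelian group on pairs \<open>(x, y)\<close> modulo the subgroup generated by the elements expressing
  biadditivity and \<open>S\<close>-balancedness.
\<close>

definition tensor_free ::
  "('r, 's, 'm, 'c) bimodule_scheme \<Rightarrow> ('s, 't, 'n, 'd) bimodule_scheme \<Rightarrow>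
    (('m \<times> 'n) \<Rightarrow>\<^sub>0 int) monoid" where
  "tensor_free M N = free_Abelian_group (carrier M \<times> carrier N)"

definition tensor_relators ::
  "('s, 'a) ring_scheme \<Rightarrow> ('r, 's, 'm, 'c) bimodule_scheme \<Rightarrow>
    ('s, 't, 'n, 'd) bimodule_scheme \<Rightarrow> (('m \<times> 'n) \<Rightarrow>\<^sub>0 int) set" where
  "tensor_relators S M N =
    {frag_of (x \<oplus>\<^bsub>M\<^esub> x', y) - frag_of (x, y) - frag_of (x', y) | x x' y.
      x \<in> carrier M \<and> x' \<in> carrier M \<and> y \<in> carrier N} \<union>
    {frag_of (x, y \<oplus>\<^bsub>N\<^esub> y') - frag_of (x, y) - frag_of (x, y') | x y y'.
      x \<in> carrier M \<and> y \<in> carrier N \<and> y' \<in> carrier N} \<union>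
    {frag_of (rsmult M x s, y) - frag_of (x, lsmult N s y) | x s y.
      x \<in> carrier M \<and> s \<in> carrier S \<and> y \<in> carrier N}"

definition tensor_kernel ::
  "('s, 'a) ring_scheme \<Rightarrow> ('r, 's, 'm, 'c) bimodule_scheme \<Rightarrow>
    ('s, 't, 'n, 'd) bimodule_scheme \<Rightarrow> (('m \<times> 'n) \<Rightarrow>\<^sub>0 int) set" where
  "tensor_kernel S M N = generate (tensor_free M N) (tensor_relators S M N)"

text \<open>
  Elements of the tensor product are cosets. The actions are \<open>r (x \<otimes> y) = (r x) \<otimes> y\<close> and
  \<open>(x \<otimes> y) t = x \<otimes> (y t)\<close>, extended additively; the union over the representatives \<open>u\<close> of a coset
  \<open>X\<close> is a single coset, because the result does not depend on \<open>u\<close>.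
\<close>

definition tensor_bimodule ::
  "('s, 'a) ring_scheme \<Rightarrow> ('r, 's, 'm, 'c) bimodule_scheme \<Rightarrow>
    ('s, 't, 'n, 'd) bimodule_scheme \<Rightarrow> ('r, 't, (('m \<times> 'n) \<Rightarrow>\<^sub>0 int) set) bimodule" where
  "tensor_bimodule S M N =
    (let F = tensor_free M N; K = tensor_kernel S M N in
      \<lparr>carrier = carrier (F Mod K), monoid.mult = undefined, one = undefined,
       ring.zero = \<one>\<^bsub>F Mod K\<^esub>, add = (\<otimes>\<^bsub>F Mod K\<^esub>),
       lsmult = (\<lambda>r X. \<Union>u\<in>X. K #>\<^bsub>F\<^esub> frag_extend (\<lambda>(x, y). frag_of (lsmult M r x, y)) u),
       rsmult = (\<lambda>X t. \<Union>u\<in>X. K #>\<^bsub>F\<^esub> frag_extend (\<lambda>(x, y). frag_of (x, rsmult N y t)) u)\<rparr>)"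


section \<open>Depth two ring extensions\<close>

text \<open>
  A ring extension \<open>A | B\<close> is given by a unital ring homomorphism \<open>\<phi> : B \<rightarrow> A\<close>, that is,
  by \<open>ring_hom_ring B A \<phi>\<close>.
\<close>

definition left_depth_two ::
  "('b, 'c) ring_scheme \<Rightarrow> ('a, 'd) ring_scheme \<Rightarrow> ('b \<Rightarrow> 'a) \<Rightarrow> bool" where
  "left_depth_two B A \<phi> \<longleftrightarrow>
    (\<exists>n>0. iso_to_direct_summand B A
      (tensor_bimodule B (ring_bimodule \<phi> \<phi> A) (ring_bimodule \<phi> (\<lambda>a. a) A))
      (bimodule_power (ring_bimodule \<phi> (\<lambda>a. a) A) n))"

definition right_depth_two ::
  "('b, 'c) ring_scheme \<Rightarrow> ('a, 'd) ring_scheme \<Rightarrow> ('b \<Rightarrow> 'a) \<Rightarrow> bool" where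
  "right_depth_two B A \<phi> \<longleftrightarrow>
    (\<exists>n>0. iso_to_direct_summand A B
      (tensor_bimodule B (ring_bimodule (\<lambda>a. a) \<phi> A) (ring_bimodule \<phi> \<phi> A))
      (bimodule_power (ring_bimodule (\<lambda>a. a) \<phi> A) n))"

definition depth_two ::
  "('b, 'c) ring_scheme \<Rightarrow> ('a, 'd) ring_scheme \<Rightarrow> ('b \<Rightarrow> 'a) \<Rightarrow> bool" where
  "depth_two B A \<phi> \<longleftrightarrow>
    ring_hom_ring B A \<phi> \<and> left_depth_two B A \<phi> \<and> right_depth_two B A \<phi>"


section \<open>Complex group algebras\<close>

text \<open>
  Elements are finitely supported functions on the whole type that vanish off \<open>carrier G\<close>. Thus for
  a subgroup \<open>H\<close> the algebra of \<open>G\<lparr>carrier := H\<rparr>\<close> is literally a subset of that of \<open>G\<close>, and the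
  inclusion is the identity function.
\<close>

definition group_algebra :: "('g, 'a) monoid_scheme \<Rightarrow> ('g \<Rightarrow> complex) ring" where
  "group_algebra G =
    \<lparr>carrier = {f. finite {x. f x \<noteq> 0} \<and> {x. f x \<noteq> 0} \<subseteq> carrier G},
     monoid.mult = (\<lambda>f g x. \<Sum>(y, z) | f y \<noteq> 0 \<and> g z \<noteq> 0 \<and> y \<otimes>\<^bsub>G\<^esub> z = x. f y * g z),
     one = (\<lambda>x. if x = \<one>\<^bsub>G\<^esub> then 1 else 0),
     ring.zero = (\<lambda>x. 0),
     add = (\<lambda>f g x. f x + g x)\<rparr>"


section \<open>The constructions are bimodules and ring extensions\<close>

lemma bimodule_ring_bimodule:
  assumes "ring R" "ring S" "ring A" "f \<in> ring_hom R A" "g \<in> ring_hom S A"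
  shows "bimodule R S (ring_bimodule f g A)"
proof -
  interpret A: ring A by fact
  interpret f: ring_hom_ring R A f using assms by (intro ring_hom_ring.intro) (auto simp: ring_hom_ring_axioms_def)
  interpret g: ring_hom_ring S A g using assms by (intro ring_hom_ring.intro) (auto simp: ring_hom_ring_axioms_def)
  have "abelian_group (ring_bimodule f g A)"
    by (rule abelian_groupI)
      (auto simp: ring_bimodule_def A.a_ac intro: A.l_neg bexI[of _ "\<ominus>\<^bsub>A\<^esub> _"])
  then show ?thesis
    using assms
    by (intro bimodule.intro bimodule_axioms.intro)
      (auto simp: ring_bimodule_def A.l_distr A.r_distr A.m_assoc)
qed

lemma bimodule_bimodule_power:
  assumes "bimodule R S M"
  shows "bimodule R S (bimodule_power M n)"
proof -
  interpret M: bimodule R S M by fact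
  have "abelian_group (bimodule_power M n)"
  proof (rule abelian_groupI)
    fix x assume "x \<in> carrier (bimodule_power M n)"
    then show "\<exists>y\<in>carrier (bimodule_power M n). y \<oplus>\<^bsub>bimodule_power M n\<^esub> x = \<zero>\<^bsub>bimodule_power M n\<^esub>"
      by (intro bexI[of _ "\<lambda>i\<in>{..<n}. \<ominus>\<^bsub>M\<^esub> x i"])
        (auto simp: bimodule_power_def PiE_iff M.l_neg fun_eq_iff)
  qed (auto simp: bimodule_power_def PiE_iff M.a_ac fun_eq_iff extensional_def)
  then show ?thesis
    by (intro bimodule.intro bimodule_axioms.intro M.R.ring_axioms M.S.ring_axioms)
      (auto simp: bimodule_power_def PiE_iff extensional_def fun_eq_iff
        M.lsmult_closed M.rsmult_closed M.lsmult_distrib M.rsmult_distrib M.lsmult_distrib_ring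
        M.rsmult_distrib_ring M.lsmult_assoc M.rsmult_assoc M.lsmult_one M.rsmult_one M.smult_commute)
qed

lemma bimodule_tensor_bimodule:
  fixes M :: "('r, 's, 'm, 'c) bimodule_scheme" and N :: "('s, 't, 'n, 'd) bimodule_scheme"
  assumes "bimodule R S M" "bimodule S T N"
  shows "bimodule R T (tensor_bimodule S M N)"
proof -
  interpret M: bimodule R S M by fact
  interpret N: bimodule S T N by fact
  define F where "F = tensor_free M N"
  define K where "K = tensor_kernel S M N"
  define D where "D = tensor_relators S M N"
  have F: "F = free_Abelian_group (carrier M \<times> carrier N)" by (simp add: F_def tensor_free_def)
  interpret F: comm_group F by (simp add: F abelian_free_Abelian_group)
  have cF: "u \<in> carrier F \<longleftrightarrow> Poly_Mapping.keys u \<subseteq> carrier M \<times> carrier N" for u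
    by (simp add: F)
  have opF [simp]: "u \<otimes>\<^bsub>F\<^esub> v = u + v" "\<one>\<^bsub>F\<^esub> = 0" for u v by (simp_all add: F)
  have invF: "inv\<^bsub>F\<^esub> u = - u" if "u \<in> carrier F" for u
    using that by (simp add: F)
  have plusF: "u + v \<in> carrier F" "u - v \<in> carrier F" if "u \<in> carrier F" "v \<in> carrier F" for u v
    using that F.m_closed[of u v] F.m_closed[of u "- v"] F.inv_closed[of v] invF[of v] by auto
  have ofF [simp]: "frag_of (x, y) \<in> carrier F \<longleftrightarrow> x \<in> carrier M \<and> y \<in> carrier N" for x y
    by (simp add: F)
  have DF: "D \<subseteq> carrier F"
    unfolding D_def tensor_relators_def
    by (auto intro!: plusF simp: M.rsmult_closed N.lsmult_closed)
  have Kgen: "K = generate F D" by (simp add: K_def D_def F_def tensor_kernel_def)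
  have subK: "subgroup K F" unfolding Kgen by (rule F.generate_is_subgroup[OF DF])
  interpret K: normal K F by (rule F.subgroup_imp_normal[OF subK])
  have KF: "u \<in> K \<Longrightarrow> u \<in> carrier F" for u using K.subset by blast
  have K0: "0 \<in> K" using K.one_closed by simp
  have Kplus: "u + v \<in> K" "u - v \<in> K" "- u \<in> K" if "u \<in> K" "v \<in> K" for u v
    using that K.m_closed[of u v] K.m_closed[of u "-v"] K.m_inv_closed[of v] K.m_inv_closed[of u] invF KF by auto
  have DK: "D \<subseteq> K" unfolding Kgen by (auto intro: generate.incl)
  have coset: "K #>\<^bsub>F\<^esub> u = {k + u | k. k \<in> K}" for u by (auto simp: r_coset_def)
  have coset_eq: "K #>\<^bsub>F\<^esub> u = K #>\<^bsub>F\<^esub> v" if "u - v \<in> K" for u v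
  proof -
    have "k + u \<in> K #>\<^bsub>F\<^esub> v" if "k \<in> K" for k
      unfolding coset using Kplus(1)[OF that \<open>u - v \<in> K\<close>] by (auto intro!: exI[of _ "k + (u - v)"])
    moreover have "k + v \<in> K #>\<^bsub>F\<^esub> u" if "k \<in> K" for k
      unfolding coset using Kplus(2)[OF that \<open>u - v \<in> K\<close>] by (auto intro!: exI[of _ "k - (u - v)"])
    ultimately have "\<forall>w \<in> K #>\<^bsub>F\<^esub> u. w \<in> K #>\<^bsub>F\<^esub> v" "\<forall>w \<in> K #>\<^bsub>F\<^esub> v. w \<in> K #>\<^bsub>F\<^esub> u"
      using coset[of u] coset[of v] by fastforce+
    then show ?thesis by blast
  qed
  have cM: "X \<in> carrier (F Mod K) \<longleftrightarrow> (\<exists>u\<in>carrier F. X = K #>\<^bsub>F\<^esub> u)" for X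
    by (auto simp: FactGroup_def RCOSETS_def)
  have addM: "(K #>\<^bsub>F\<^esub> u) \<otimes>\<^bsub>F Mod K\<^esub> (K #>\<^bsub>F\<^esub> v) = K #>\<^bsub>F\<^esub> (u + v)"
    if "u \<in> carrier F" "v \<in> carrier F" for u v
    using K.rcos_sum[OF that] by simp
  define act where "act \<phi> X = (\<Union>u\<in>X. K #>\<^bsub>F\<^esub> frag_extend \<phi> u)" for \<phi> :: "'m \<times> 'n \<Rightarrow> ('m \<times> 'n) \<Rightarrow>\<^sub>0 int" and X
  have extF: "frag_extend \<phi> u \<in> carrier F"
    if "u \<in> carrier F" "\<And>x y. x \<in> carrier M \<Longrightarrow> y \<in> carrier N \<Longrightarrow> \<phi> (x, y) \<in> carrier F" for \<phi> :: "'m \<times> 'n \<Rightarrow> ('m \<times> 'n) \<Rightarrow>\<^sub>0 int" and u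
  proof -
    have "Poly_Mapping.keys (\<phi> p) \<subseteq> carrier M \<times> carrier N" if "p \<in> Poly_Mapping.keys u" for p
    proof -
      have "p \<in> carrier M \<times> carrier N"
        using \<open>u \<in> carrier F\<close> that unfolding cF by (rule subsetD)
      then have "\<phi> p \<in> carrier F" using \<open>\<And>x y. x \<in> carrier M \<Longrightarrow> y \<in> carrier N \<Longrightarrow> \<phi> (x, y) \<in> carrier F\<close>
        by (cases p) simp
      then show ?thesis by (simp only: cF)
    qed
    then have "(\<Union>p \<in> Poly_Mapping.keys u. Poly_Mapping.keys (\<phi> p)) \<subseteq> carrier M \<times> carrier N"
      by (rule UN_least)
    with keys_frag_extend[of \<phi> u] show ?thesis unfolding cF by (rule order.trans)
  qed
  have extK: "frag_extend \<phi> u \<in> K" if "u \<in> K" "\<And>d. d \<in> D \<Longrightarrow> frag_extend \<phi> d \<in> K" for \<phi> :: "'m \<times> 'n \<Rightarrow> ('m \<times> 'n) \<Rightarrow>\<^sub>0 int" and u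
  proof -
    have "u \<in> generate F D" using that(1) by (simp only: Kgen)
    then show ?thesis
    proof (induction rule: generate.induct)
      case one then show ?case using K0 by simp
    next
      case (incl h) then show ?case by (rule that(2))
    next
      case (inv h)
      then have "inv\<^bsub>F\<^esub> h = - h" "frag_extend \<phi> h \<in> K" using DF that(2) invF by blast+
      then show ?case using Kplus(3) by (simp only: frag_extend_minus)
    next
      case (eng h1 h2) then show ?case using Kplus(1) by (simp only: frag_extend_add opF)
    qed
  qed
  have act: "act \<phi> (K #>\<^bsub>F\<^esub> u) = K #>\<^bsub>F\<^esub> frag_extend \<phi> u"
    if phi: "\<And>d. d \<in> D \<Longrightarrow> frag_extend \<phi> d \<in> K" for \<phi> :: "'m \<times> 'n \<Rightarrow> ('m \<times> 'n) \<Rightarrow>\<^sub>0 int" and u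
  proof -
    have "K #>\<^bsub>F\<^esub> frag_extend \<phi> v = K #>\<^bsub>F\<^esub> frag_extend \<phi> u" if v: "v \<in> K #>\<^bsub>F\<^esub> u" for v
    proof -
      obtain k where k: "k \<in> K" "v = k + u" using v by (auto simp: coset)
      have "frag_extend \<phi> v - frag_extend \<phi> u = frag_extend \<phi> k" by (simp add: k(2) frag_extend_add)
      with extK[OF k(1) phi] show ?thesis by (intro coset_eq) simp
    qed
    moreover have "u \<in> K #>\<^bsub>F\<^esub> u" using K0 by (auto simp: coset)
    ultimately show ?thesis unfolding act_def by blast
  qed
  define l where "l r = (\<lambda>(x, y). frag_of (lsmult M r x, y :: 'n))" for r
  define t where "t s = (\<lambda>(x :: 'm, y). frag_of (x, rsmult N y s))" for s
  have DI: "frag_of (x \<oplus>\<^bsub>M\<^esub> x', y) - frag_of (x, y) - frag_of (x', y) \<in> K"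
    if "x \<in> carrier M" "x' \<in> carrier M" "y \<in> carrier N" for x x' y
    by (rule subsetD[OF DK], unfold D_def tensor_relators_def, rule UnI1, rule UnI1,
      intro CollectI exI conjI, rule refl) (rule that)+
  have DI2: "frag_of (x, y \<oplus>\<^bsub>N\<^esub> y') - frag_of (x, y) - frag_of (x, y') \<in> K"
    if "x \<in> carrier M" "y \<in> carrier N" "y' \<in> carrier N" for x y y'
    by (rule subsetD[OF DK], unfold D_def tensor_relators_def, rule UnI1, rule UnI2,
      intro CollectI exI conjI, rule refl) (rule that)+
  have DI3: "frag_of (rsmult M x s, y) - frag_of (x, lsmult N s y) \<in> K"
    if "x \<in> carrier M" "s \<in> carrier S" "y \<in> carrier N" for x s y
    by (rule subsetD[OF DK], unfold D_def tensor_relators_def, rule UnI2,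
      intro CollectI exI conjI, rule refl) (rule that)+
  have lD: "frag_extend (l r) d \<in> K" if "d \<in> D" "r \<in> carrier R" for d r
    using that unfolding D_def tensor_relators_def
    by (auto simp: l_def frag_extend_diff M.lsmult_distrib M.smult_commute[symmetric] M.lsmult_closed
        intro!: DI DI2 DI3 )
  have tD: "frag_extend (t s) d \<in> K" if "d \<in> D" "s \<in> carrier T" for d s
    using that unfolding D_def tensor_relators_def
    by (auto simp: t_def frag_extend_diff N.rsmult_distrib N.smult_commute N.rsmult_closed
        intro!: DI DI2 DI3 )
  have lF: "frag_extend (l r) u \<in> carrier F" if "u \<in> carrier F" "r \<in> carrier R" for r u
    by (rule extF[OF that(1)]) (use that in \<open>auto simp: l_def M.lsmult_closed\<close>)
  have tF: "frag_extend (t r) u \<in> carrier F" if "u \<in> carrier F" "r \<in> carrier T" for r u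
    by (rule extF[OF that(1)]) (use that in \<open>auto simp: t_def N.rsmult_closed\<close>)
  have ind: "P u" if u: "u \<in> carrier F" and "P 0" "\<And>x y. x \<in> carrier M \<Longrightarrow> y \<in> carrier N \<Longrightarrow> P (frag_of (x, y))"
    "\<And>u v. P u \<Longrightarrow> P v \<Longrightarrow> P (u - v)" for P u
    using u unfolding cF by (induction u rule: frag_induction) (use that in auto)
  have L: "act (l r) (K #>\<^bsub>F\<^esub> u) = K #>\<^bsub>F\<^esub> frag_extend (l r) u" if "r \<in> carrier R" for r u
    by (rule act) (use that lD in auto)
  have R: "act (t r) (K #>\<^bsub>F\<^esub> u) = K #>\<^bsub>F\<^esub> frag_extend (t r) u" if "r \<in> carrier T" for r u
    by (rule act) (use that tD in auto)
  let ?T = "tensor_bimodule S M N"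
  have T: "carrier ?T = carrier (F Mod K)" "add ?T = (\<otimes>\<^bsub>F Mod K\<^esub>)" "\<zero>\<^bsub>?T\<^esub> = \<one>\<^bsub>F Mod K\<^esub>"
    "lsmult ?T r X = act (l r) X" "rsmult ?T X s = act (t s) X" for r X s
    by (simp_all add: tensor_bimodule_def Let_def F_def K_def act_def l_def t_def)
  have "comm_group (F Mod K)" 
    by (rule F.abelian_FactGroup) (rule subK)
  then interpret Q: comm_group "F Mod K" .
  have ab: "abelian_group ?T"
    by (rule abelian_groupI) (simp_all add: T Q.m_ac Q.l_inv_ex del: one_FactGroup mult_FactGroup)
  show ?thesis
  proof (intro bimodule.intro bimodule_axioms.intro ab M.R.ring_axioms N.S.ring_axioms; unfold T cM; (elim bexE)?; hypsubst)
    fix r u assume a: "r \<in> carrier R" "u \<in> carrier F"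
    then show "\<exists>v\<in>carrier F. act (l r) (K #>\<^bsub>F\<^esub> u) = K #>\<^bsub>F\<^esub> v" using L lF by blast
    fix v assume "v \<in> carrier F"
    with a show "act (l r) ((K #>\<^bsub>F\<^esub> u) \<otimes>\<^bsub>F Mod K\<^esub> (K #>\<^bsub>F\<^esub> v)) = act (l r) (K #>\<^bsub>F\<^esub> u) \<otimes>\<^bsub>F Mod K\<^esub> act (l r) (K #>\<^bsub>F\<^esub> v)"
      by (simp add: L addM lF plusF frag_extend_add del: mult_FactGroup)
  next
    fix r u assume a: "r \<in> carrier T" "u \<in> carrier F"
    then show "\<exists>v\<in>carrier F. act (t r) (K #>\<^bsub>F\<^esub> u) = K #>\<^bsub>F\<^esub> v" using R tF by blast
    fix v assume "v \<in> carrier F"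
    with a show "act (t r) ((K #>\<^bsub>F\<^esub> u) \<otimes>\<^bsub>F Mod K\<^esub> (K #>\<^bsub>F\<^esub> v)) = act (t r) (K #>\<^bsub>F\<^esub> u) \<otimes>\<^bsub>F Mod K\<^esub> act (t r) (K #>\<^bsub>F\<^esub> v)"
      by (simp add: R addM tF plusF frag_extend_add del: mult_FactGroup)
  next
    fix r r' u assume a: "r \<in> carrier R" "r' \<in> carrier R" and u: "u \<in> carrier F"
    have "frag_extend (l (r \<oplus>\<^bsub>R\<^esub> r')) u - (frag_extend (l r) u + frag_extend (l r') u) \<in> K"
    proof (rule ind[OF u], goal_cases)
      case (3 u v) from Kplus(2)[OF this] show ?case by (simp add: frag_extend_diff algebra_simps)
    qed (use a DI K0 in \<open>auto simp: l_def M.lsmult_distrib_ring M.lsmult_closed diff_diff_eq[symmetric]\<close>)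
    then show "act (l (r \<oplus>\<^bsub>R\<^esub> r')) (K #>\<^bsub>F\<^esub> u) = act (l r) (K #>\<^bsub>F\<^esub> u) \<otimes>\<^bsub>F Mod K\<^esub> act (l r') (K #>\<^bsub>F\<^esub> u)"
      using a u by (simp add: L addM lF coset_eq del: mult_FactGroup)
    have "frag_extend (l (r \<otimes>\<^bsub>R\<^esub> r')) u = frag_extend (l r) (frag_extend (l r') u)"
      by (rule ind[OF u]) (use a in \<open>auto simp: l_def M.lsmult_assoc frag_extend_diff\<close>)
    then show "act (l (r \<otimes>\<^bsub>R\<^esub> r')) (K #>\<^bsub>F\<^esub> u) = act (l r) (act (l r') (K #>\<^bsub>F\<^esub> u))"
      using a by (simp add: L)
  next
    fix r r' u assume a: "r \<in> carrier T" "r' \<in> carrier T" and u: "u \<in> carrier F"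
    have "frag_extend (t (r \<oplus>\<^bsub>T\<^esub> r')) u - (frag_extend (t r) u + frag_extend (t r') u) \<in> K"
    proof (rule ind[OF u], goal_cases)
      case (3 u v) from Kplus(2)[OF this] show ?case by (simp add: frag_extend_diff algebra_simps)
    qed (use a DI2 K0 in \<open>auto simp: t_def N.rsmult_distrib_ring N.rsmult_closed diff_diff_eq[symmetric]\<close>)
    then show "act (t (r \<oplus>\<^bsub>T\<^esub> r')) (K #>\<^bsub>F\<^esub> u) = act (t r) (K #>\<^bsub>F\<^esub> u) \<otimes>\<^bsub>F Mod K\<^esub> act (t r') (K #>\<^bsub>F\<^esub> u)"
      using a u by (simp add: R addM tF coset_eq del: mult_FactGroup)
    have "frag_extend (t (r \<otimes>\<^bsub>T\<^esub> r')) u = frag_extend (t r') (frag_extend (t r) u)"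
      by (rule ind[OF u]) (use a in \<open>auto simp: t_def N.rsmult_assoc frag_extend_diff\<close>)
    then show "act (t (r \<otimes>\<^bsub>T\<^esub> r')) (K #>\<^bsub>F\<^esub> u) = act (t r') (act (t r) (K #>\<^bsub>F\<^esub> u))"
      using a by (simp add: R)
  next
    fix r s u assume a: "r \<in> carrier R" "s \<in> carrier T" and u: "u \<in> carrier F"
    have "frag_extend (t s) (frag_extend (l r) u) = frag_extend (l r) (frag_extend (t s) u)"
      by (rule ind[OF u]) (auto simp: l_def t_def frag_extend_diff)
    then show "act (t s) (act (l r) (K #>\<^bsub>F\<^esub> u)) = act (l r) (act (t s) (K #>\<^bsub>F\<^esub> u))"
      using a by (simp add: L R)
  next
    fix u assume u: "u \<in> carrier F"
    have "frag_extend (l \<one>\<^bsub>R\<^esub>) u = u" "frag_extend (t \<one>\<^bsub>T\<^esub>) u = u"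
      by (rule ind[OF u]; auto simp: l_def t_def frag_extend_diff M.lsmult_one N.rsmult_one)+
    then show "act (l \<one>\<^bsub>R\<^esub>) (K #>\<^bsub>F\<^esub> u) = K #>\<^bsub>F\<^esub> u" "act (t \<one>\<^bsub>T\<^esub>) (K #>\<^bsub>F\<^esub> u) = K #>\<^bsub>F\<^esub> u"
      by (simp_all add: L R)
  qed
qed

lemma group_algebra_mult:
  assumes "finite X" "finite Y" "{y. f y \<noteq> 0} \<subseteq> X" "{z. g z \<noteq> 0} \<subseteq> Y"
  shows "(f \<otimes>\<^bsub>group_algebra G\<^esub> g) x =
    (\<Sum>y\<in>X. \<Sum>z\<in>Y. if y \<otimes>\<^bsub>G\<^esub> z = x then f y * g z else 0)"
proof -
  have "(f \<otimes>\<^bsub>group_algebra G\<^esub> g) x =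
     (\<Sum>(y, z) \<in> {(y, z). f y \<noteq> 0 \<and> g z \<noteq> 0 \<and> y \<otimes>\<^bsub>G\<^esub> z = x}. f y * g z)"
    by (simp add: group_algebra_def)
  also have "\<dots> = (\<Sum>(y, z) \<in> X \<times> Y. if y \<otimes>\<^bsub>G\<^esub> z = x then f y * g z else 0)"
    using assms by (intro sum.mono_neutral_cong_left) (auto split: if_splits)
  finally show ?thesis by (simp add: sum.cartesian_product)
qed

lemma sum_rotate3:
  "(\<Sum>u\<in>U. \<Sum>a\<in>A. \<Sum>b\<in>B. k u a b) = (\<Sum>a\<in>A. \<Sum>b\<in>B. \<Sum>u\<in>U. k u a b)"
  by (subst sum.swap, intro sum.cong refl, rule sum.swap)

lemma sum_rotate4:
  "(\<Sum>u\<in>U. \<Sum>c\<in>C. \<Sum>a\<in>A. \<Sum>b\<in>B. k u c a b) = (\<Sum>c\<in>C. \<Sum>a\<in>A. \<Sum>b\<in>B. \<Sum>u\<in>U. k u c a b)"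
  by (subst sum.swap, intro sum.cong refl, rule sum_rotate3)

lemma ring_group_algebra:
  assumes "group G" 
  shows "ring (group_algebra G)"
proof -
  interpret group G by fact
  let ?A = "group_algebra G"
  define s where "s f = {x. f x \<noteq> 0}" for f :: "'a \<Rightarrow> complex"
  have fs: "finite (s f)" "s f \<subseteq> carrier G" if "f \<in> carrier ?A" for f
    using that by (auto simp: group_algebra_def s_def)
  define P where "P X Y = (\<lambda>(y, z). y \<otimes>\<^bsub>G\<^esub> z) ` (X \<times> Y)" for X Y
  have m: "(f \<otimes>\<^bsub>?A\<^esub> g) x = (\<Sum>y\<in>X. \<Sum>z\<in>Y. if y \<otimes>\<^bsub>G\<^esub> z = x then f y * g z else 0)"
    if "finite X" "finite Y" "s f \<subseteq> X" "s g \<subseteq> Y" for f g x X Y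
    using group_algebra_mult that by (auto simp: s_def)
  have sP: "s (f \<otimes>\<^bsub>?A\<^esub> g) \<subseteq> P (s f) (s g)" if "f \<in> carrier ?A" "g \<in> carrier ?A" for f g
  proof 
    fix x assume "x \<in> s (f \<otimes>\<^bsub>?A\<^esub> g)"
    then have "(\<Sum>y\<in>s f. \<Sum>z\<in>s g. if y \<otimes>\<^bsub>G\<^esub> z = x then f y * g z else 0) \<noteq> 0"
      using m[OF fs(1) fs(1), OF that order.refl order.refl] by (simp add: s_def)
    then obtain y where "y \<in> s f" "(\<Sum>z\<in>s g. if y \<otimes>\<^bsub>G\<^esub> z = x then f y * g z else 0) \<noteq> 0"
      by (rule sum.not_neutral_contains_not_neutral)
    moreover from this(2) obtain z where "z \<in> s g" "(if y \<otimes>\<^bsub>G\<^esub> z = x then f y * g z else 0) \<noteq> 0"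
      by (rule sum.not_neutral_contains_not_neutral)
    ultimately have "y \<in> s f" "z \<in> s g" "y \<otimes>\<^bsub>G\<^esub> z = x" by (auto split: if_splits)
    then show "x \<in> P (s f) (s g)" by (auto simp: P_def)
  qed
  have fP: "finite (P (s f) (s g))" if "f \<in> carrier ?A" "g \<in> carrier ?A" for f g
    using that fs unfolding P_def by blast
  have closed: "f \<otimes>\<^bsub>?A\<^esub> g \<in> carrier ?A" if "f \<in> carrier ?A" "g \<in> carrier ?A" for f g
  proof -
    have "P (s f) (s g) \<subseteq> carrier G" using fs that unfolding P_def by fast
    then have "finite (s (f \<otimes>\<^bsub>?A\<^esub> g))" "s (f \<otimes>\<^bsub>?A\<^esub> g) \<subseteq> carrier G"
      using sP[OF that] fP[OF that] by (auto intro: finite_subset)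
    then show ?thesis by (simp add: group_algebra_def s_def)
  qed
  have assoc: "f \<otimes>\<^bsub>?A\<^esub> g \<otimes>\<^bsub>?A\<^esub> h = f \<otimes>\<^bsub>?A\<^esub> (g \<otimes>\<^bsub>?A\<^esub> h)" 
    if f: "f \<in> carrier ?A" and g: "g \<in> carrier ?A" and h: "h \<in> carrier ?A" for f g h
  proof
    fix x
    let ?F = "s f" and ?G = "s g" and ?H = "s h"
    note fin = fs(1)[OF f] fs(1)[OF g] fs(1)[OF h]
    have "(f \<otimes>\<^bsub>?A\<^esub> g \<otimes>\<^bsub>?A\<^esub> h) x = (\<Sum>u\<in>P ?F ?G. \<Sum>c\<in>?H. if u \<otimes>\<^bsub>G\<^esub> c = x then (f \<otimes>\<^bsub>?A\<^esub> g) u * h c else 0)"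
      by (rule m) (use fP sP fin f g in auto)
    also have "\<dots> = (\<Sum>u\<in>P ?F ?G. \<Sum>c\<in>?H. \<Sum>a\<in>?F. \<Sum>b\<in>?G. if a \<otimes>\<^bsub>G\<^esub> b = u then (if u \<otimes>\<^bsub>G\<^esub> c = x then f a * g b * h c else 0) else 0)"
      by (intro sum.cong refl) (auto simp: m[OF fin(1,2)] sum_distrib_right intro!: sum.cong sum.neutral)
    also have "\<dots> = (\<Sum>c\<in>?H. \<Sum>a\<in>?F. \<Sum>b\<in>?G. \<Sum>u\<in>P ?F ?G. if a \<otimes>\<^bsub>G\<^esub> b = u then (if u \<otimes>\<^bsub>G\<^esub> c = x then f a * g b * h c else 0) else 0)"
      by (rule sum_rotate4)
    also have "\<dots> = (\<Sum>c\<in>?H. \<Sum>a\<in>?F. \<Sum>b\<in>?G. if a \<otimes>\<^bsub>G\<^esub> b \<otimes>\<^bsub>G\<^esub> c = x then f a * g b * h c else 0)"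
      by (intro sum.cong refl, subst sum.delta') (use fP f g in \<open>auto simp: P_def\<close>)
    also have "\<dots> = (\<Sum>a\<in>?F. \<Sum>b\<in>?G. \<Sum>c\<in>?H. if a \<otimes>\<^bsub>G\<^esub> (b \<otimes>\<^bsub>G\<^esub> c) = x then f a * (g b * h c) else 0)"
      using fs(2) f g h
      by (subst sum_rotate3, intro sum.cong refl) (auto simp: m_assoc subset_iff)
    also have "\<dots> = (\<Sum>a\<in>?F. \<Sum>b\<in>?G. \<Sum>c\<in>?H. \<Sum>u\<in>P ?G ?H. if b \<otimes>\<^bsub>G\<^esub> c = u then (if a \<otimes>\<^bsub>G\<^esub> u = x then f a * (g b * h c) else 0) else 0)"
      by (intro sum.cong refl, subst sum.delta') (use fP g h in \<open>auto simp: P_def\<close>)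
    also have "\<dots> = (\<Sum>a\<in>?F. \<Sum>u\<in>P ?G ?H. \<Sum>b\<in>?G. \<Sum>c\<in>?H. if b \<otimes>\<^bsub>G\<^esub> c = u then (if a \<otimes>\<^bsub>G\<^esub> u = x then f a * (g b * h c) else 0) else 0)"
      by (rule sum.cong[OF refl], rule sum_rotate3[symmetric])
    also have "\<dots> = (\<Sum>a\<in>?F. \<Sum>u\<in>P ?G ?H. if a \<otimes>\<^bsub>G\<^esub> u = x then f a * (g \<otimes>\<^bsub>?A\<^esub> h) u else 0)"
      by (intro sum.cong refl) (auto simp: m[OF fin(2,3)] sum_distrib_left intro!: sum.cong sum.neutral)
    also have "\<dots> = (f \<otimes>\<^bsub>?A\<^esub> (g \<otimes>\<^bsub>?A\<^esub> h)) x"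
      by (rule m[symmetric]) (use fP sP fin g h in auto)
    finally show "(f \<otimes>\<^bsub>?A\<^esub> g \<otimes>\<^bsub>?A\<^esub> h) x = (f \<otimes>\<^bsub>?A\<^esub> (g \<otimes>\<^bsub>?A\<^esub> h)) x" .
  qed
  have add: "(f \<oplus>\<^bsub>?A\<^esub> g) x = f x + g x" "\<zero>\<^bsub>?A\<^esub> x = 0" for f g x by (auto simp: group_algebra_def)
  have sone: "s \<one>\<^bsub>?A\<^esub> = {\<one>\<^bsub>G\<^esub>}" "\<one>\<^bsub>?A\<^esub> \<one>\<^bsub>G\<^esub> = 1" "\<one>\<^bsub>?A\<^esub> \<in> carrier ?A" by (auto simp: s_def group_algebra_def)
  have l1: "\<one>\<^bsub>?A\<^esub> \<otimes>\<^bsub>?A\<^esub> f = f" "f \<otimes>\<^bsub>?A\<^esub> \<one>\<^bsub>?A\<^esub> = f" if f: "f \<in> carrier ?A" for f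
  proof -
    have fx: "(\<Sum>z\<in>s f. if z = x then f z else 0) = f x" for x
      using fs(1)[OF f] by (simp add: s_def)
    have "(\<one>\<^bsub>?A\<^esub> \<otimes>\<^bsub>?A\<^esub> f) x = (\<Sum>z\<in>s f. if z = x then f z else 0)" for x
      by (subst m[of "{\<one>\<^bsub>G\<^esub>}" "s f"])
        (use fs[OF f] sone in \<open>auto intro!: sum.cong simp: subset_iff\<close>)
    moreover have "(f \<otimes>\<^bsub>?A\<^esub> \<one>\<^bsub>?A\<^esub>) x = (\<Sum>z\<in>s f. if z = x then f z else 0)" for x
      by (subst m[of "s f" "{\<one>\<^bsub>G\<^esub>}"])
        (use fs[OF f] sone in \<open>auto intro!: sum.cong simp: subset_iff\<close>)
    ultimately show "\<one>\<^bsub>?A\<^esub> \<otimes>\<^bsub>?A\<^esub> f = f" "f \<otimes>\<^bsub>?A\<^esub> \<one>\<^bsub>?A\<^esub> = f"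
      unfolding fx by (auto simp: fun_eq_iff)
  qed
  have ab: "abelian_group ?A"
  proof (rule abelian_groupI)
    fix f g assume a: "f \<in> carrier ?A" "g \<in> carrier ?A"
    have "s (f \<oplus>\<^bsub>?A\<^esub> g) \<subseteq> s f \<union> s g" by (auto simp: s_def add)
    then have "finite (s (f \<oplus>\<^bsub>?A\<^esub> g))" "s (f \<oplus>\<^bsub>?A\<^esub> g) \<subseteq> carrier G"
      using fs a by (auto intro: finite_subset)
    then show "f \<oplus>\<^bsub>?A\<^esub> g \<in> carrier ?A" by (simp add: group_algebra_def s_def)
  next
    fix f assume "f \<in> carrier ?A"
    then show "\<exists>g\<in>carrier ?A. g \<oplus>\<^bsub>?A\<^esub> f = \<zero>\<^bsub>?A\<^esub>"
      by (intro bexI[of _ "\<lambda>x. - f x"]) (auto simp: group_algebra_def)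
  qed (auto simp: group_algebra_def fun_eq_iff)
  show ?thesis
  proof (rule ringI[OF ab])
    show "monoid ?A" by (rule monoidI) (auto intro: closed assoc l1 sone)
  next
    fix f g h assume a: "f \<in> carrier ?A" "g \<in> carrier ?A" "h \<in> carrier ?A"
    let ?X = "s f \<union> s g \<union> s h"
    have fin: "finite ?X" and sub: "s (f \<oplus>\<^bsub>?A\<^esub> g) \<subseteq> ?X" using fs a by (auto simp: s_def add)
    show "(f \<oplus>\<^bsub>?A\<^esub> g) \<otimes>\<^bsub>?A\<^esub> h = f \<otimes>\<^bsub>?A\<^esub> h \<oplus>\<^bsub>?A\<^esub> g \<otimes>\<^bsub>?A\<^esub> h"
    proof
      fix x
      have "((f \<oplus>\<^bsub>?A\<^esub> g) \<otimes>\<^bsub>?A\<^esub> h) x = (\<Sum>y\<in>?X. \<Sum>z\<in>?X. if y \<otimes>\<^bsub>G\<^esub> z = x then (f y + g y) * h z else 0)"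
        by (subst m[OF fin fin]) (use sub in \<open>auto simp: add intro!: sum.cong\<close>)
      moreover have "(f \<otimes>\<^bsub>?A\<^esub> h) x = (\<Sum>y\<in>?X. \<Sum>z\<in>?X. if y \<otimes>\<^bsub>G\<^esub> z = x then f y * h z else 0)"
        "(g \<otimes>\<^bsub>?A\<^esub> h) x = (\<Sum>y\<in>?X. \<Sum>z\<in>?X. if y \<otimes>\<^bsub>G\<^esub> z = x then g y * h z else 0)"
        by (rule m[OF fin fin]; auto)+
      ultimately show "((f \<oplus>\<^bsub>?A\<^esub> g) \<otimes>\<^bsub>?A\<^esub> h) x = (f \<otimes>\<^bsub>?A\<^esub> h \<oplus>\<^bsub>?A\<^esub> g \<otimes>\<^bsub>?A\<^esub> h) x"
        by (auto simp: add(1) sum.distrib[symmetric] ring_distribs intro!: sum.cong)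
    qed
    show "h \<otimes>\<^bsub>?A\<^esub> (f \<oplus>\<^bsub>?A\<^esub> g) = h \<otimes>\<^bsub>?A\<^esub> f \<oplus>\<^bsub>?A\<^esub> h \<otimes>\<^bsub>?A\<^esub> g"
    proof
      fix x
      have "(h \<otimes>\<^bsub>?A\<^esub> (f \<oplus>\<^bsub>?A\<^esub> g)) x = (\<Sum>y\<in>?X. \<Sum>z\<in>?X. if y \<otimes>\<^bsub>G\<^esub> z = x then h y * (f z + g z) else 0)"
        by (subst m[OF fin fin]) (use sub in \<open>auto simp: add intro!: sum.cong\<close>)
      moreover have "(h \<otimes>\<^bsub>?A\<^esub> f) x = (\<Sum>y\<in>?X. \<Sum>z\<in>?X. if y \<otimes>\<^bsub>G\<^esub> z = x then h y * f z else 0)"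
        "(h \<otimes>\<^bsub>?A\<^esub> g) x = (\<Sum>y\<in>?X. \<Sum>z\<in>?X. if y \<otimes>\<^bsub>G\<^esub> z = x then h y * g z else 0)"
        by (rule m[OF fin fin]; auto)+
      ultimately show "(h \<otimes>\<^bsub>?A\<^esub> (f \<oplus>\<^bsub>?A\<^esub> g)) x = (h \<otimes>\<^bsub>?A\<^esub> f \<oplus>\<^bsub>?A\<^esub> h \<otimes>\<^bsub>?A\<^esub> g) x"
        by (auto simp: add(1) sum.distrib[symmetric] ring_distribs intro!: sum.cong)
    qed
  qed
qed

lemma ring_hom_group_algebra:
  assumes "group G" "subgroup H G"
  shows "ring_hom_ring (group_algebra (G\<lparr>carrier := H\<rparr>)) (group_algebra G) (\<lambda>f. f)"
proof -
  have "(\<lambda>f. f) \<in> ring_hom (group_algebra (G\<lparr>carrier := H\<rparr>)) (group_algebra G)"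
    using subgroup.subset[OF assms(2)] by (auto simp: ring_hom_def group_algebra_def)
  with assms show ?thesis
    by (auto intro!: ring_hom_ring.intro ring_group_algebra subgroup.subgroup_is_group
        simp: ring_hom_ring_axioms_def)
qed

end

theory Submission
  imports Defs
begin

text \<open>
  Right depth two embeds \<open>A \<otimes>\<^sub>B A\<close> into a power of \<open>A\<close>, so the \<open>A\<close>-\<open>B\<close>-bimodule maps
  \<open>f : A \<otimes>\<^sub>B A \<rightarrow> A\<close> separate points. Let \<open>t\<close> be the sum of all elements of \<open>G\<close>. For \<open>g \<in> G\<close> and
  \<open>k \<in> H\<close> we have \<open>f (t \<otimes> g k) = t f (1 \<otimes> g) k = t f (1 \<otimes> g) = f (t \<otimes> g)\<close>, because \<open>t a\<close> is a
  multiple of \<open>t\<close> for every \<open>a \<in> A\<close>. Hence \<open>t \<otimes> g k = t \<otimes> g\<close>. The balanced map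
  \<open>(x, y) \<mapsto> x|\<^sub>H y\<close> then gives the equality of cosets \<open>H g k = H g\<close>, that is, \<open>g k g\<^sup>-\<^sup>1 \<in> H\<close>.
\<close>

section \<open>Pure tensors\<close>

definition pure_tensor ::
  "('s, 'a) ring_scheme \<Rightarrow> ('r, 's, 'm, 'c) bimodule_scheme \<Rightarrow>
    ('s, 't, 'n, 'd) bimodule_scheme \<Rightarrow> 'm \<Rightarrow> 'n \<Rightarrow> (('m \<times> 'n) \<Rightarrow>\<^sub>0 int) set" where
  "pure_tensor S M N x y = tensor_kernel S M N #>\<^bsub>tensor_free M N\<^esub> frag_of (x, y)"

lemma comm_group_tensor_free: "comm_group (tensor_free M N)"
  by (simp add: tensor_free_def abelian_free_Abelian_group)

lemma frag_of_in_tensor_free [simp]: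
  "frag_of (x, y) \<in> carrier (tensor_free M N) \<longleftrightarrow> x \<in> carrier M \<and> y \<in> carrier N"
  by (simp add: tensor_free_def)

lemma diff_in_tensor_free:
  assumes "u \<in> carrier (tensor_free M N)" "v \<in> carrier (tensor_free M N)"
  shows "u - v \<in> carrier (tensor_free M N)"
  using assms keys_diff[of u v] by (auto simp: tensor_free_def)

lemma tensor_relators_subset:
  assumes "bimodule R S M" "bimodule S T N"
  shows "tensor_relators S M N \<subseteq> carrier (tensor_free M N)"
proof -
  interpret M: bimodule R S M by fact
  interpret N: bimodule S T N by fact
  show ?thesis
    unfolding tensor_relators_def
    by (auto intro!: diff_in_tensor_free simp: M.rsmult_closed N.lsmult_closed)
qed

lemma subgroup_tensor_kernel:
  assumes "bimodule R S M" "bimodule S T N"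
  shows "subgroup (tensor_kernel S M N) (tensor_free M N)"
  unfolding tensor_kernel_def
  by (intro group.generate_is_subgroup tensor_relators_subset[OF assms]
      comm_group.axioms(2) comm_group_tensor_free)

lemma carrier_tensor_bimodule:
  "carrier (tensor_bimodule S M N) = rcosets\<^bsub>tensor_free M N\<^esub> tensor_kernel S M N"
  by (simp add: tensor_bimodule_def FactGroup_def Let_def)

text \<open>Distinct cosets of a subgroup are disjoint. An equation between tensors therefore
  reduces to exhibiting one common representative in the free abelian group.\<close>

lemma tensor_coset_eq:
  assumes "bimodule R S M" "bimodule S T N"
    and "X \<in> carrier (tensor_bimodule S M N)" "Y \<in> carrier (tensor_bimodule S M N)"
    and "u \<in> X" "u \<in> Y"
  shows "X = Y"
proof -
  interpret F: comm_group "tensor_free M N" by (rule comm_group_tensor_free)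
  show ?thesis
    using F.rcos_disjoint[OF subgroup_tensor_kernel[OF assms(1,2)]] assms(3-)
    by (auto simp: carrier_tensor_bimodule pairwise_def disjnt_iff)
qed

lemma pure_tensor_closed:
  assumes "x \<in> carrier M" "y \<in> carrier N"
  shows "pure_tensor S M N x y \<in> carrier (tensor_bimodule S M N)"
  using assms by (auto simp: carrier_tensor_bimodule pure_tensor_def RCOSETS_def)

lemma frag_of_in_pure_tensor:
  assumes "bimodule R S M" "bimodule S T N" "x \<in> carrier M" "y \<in> carrier N"
  shows "frag_of (x, y) \<in> pure_tensor S M N x y"
proof -
  interpret F: comm_group "tensor_free M N" by (rule comm_group_tensor_free)
  show ?thesis
    unfolding pure_tensor_def
    by (rule F.rcos_self) (use assms subgroup_tensor_kernel[OF assms(1,2)] in auto)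
qed

text \<open>
  By closure under the action the left-hand side is a single coset, so it is enough that it
  contains a representative of the right-hand side.
\<close>

lemma lsmult_pure_tensor:
  assumes "bimodule R S M" "bimodule S T N" "r \<in> carrier R" "x \<in> carrier M" "y \<in> carrier N"
  shows "lsmult (tensor_bimodule S M N) r (pure_tensor S M N x y) =
    pure_tensor S M N (lsmult M r x) y"
proof (rule tensor_coset_eq[OF assms(1,2)])
  interpret M: bimodule R S M by fact
  interpret T: bimodule R T "tensor_bimodule S M N"
    by (rule bimodule_tensor_bimodule) fact+
  have rx: "lsmult M r x \<in> carrier M" using assms by (simp add: M.lsmult_closed)
  show "lsmult (tensor_bimodule S M N) r (pure_tensor S M N x y) \<in> carrier (tensor_bimodule S M N)"
    by (intro T.lsmult_closed pure_tensor_closed) fact+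
  show "pure_tensor S M N (lsmult M r x) y \<in> carrier (tensor_bimodule S M N)"
    by (rule pure_tensor_closed[OF rx assms(5)])
  show *: "frag_of (lsmult M r x, y) \<in> pure_tensor S M N (lsmult M r x) y"
    by (rule frag_of_in_pure_tensor[OF assms(1,2) rx assms(5)])
  \<comment> \<open>The witness is the coset contributed to the union by the representative
    \<open>frag_of (x, y)\<close>, which the extended action sends to
    \<open>frag_of (lsmult M r x, y)\<close>.\<close>
  show "frag_of (lsmult M r x, y) \<in> lsmult (tensor_bimodule S M N) r (pure_tensor S M N x y)"
    using * frag_of_in_pure_tensor[OF assms(1,2,4,5)]
    by (auto simp: tensor_bimodule_def Let_def pure_tensor_def[of _ _ _ "lsmult M r x"]
        intro!: bexI[of _ "frag_of (x, y)"])
qed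

lemma rsmult_pure_tensor:
  assumes "bimodule R S M" "bimodule S T N" "t \<in> carrier T" "x \<in> carrier M" "y \<in> carrier N"
  shows "rsmult (tensor_bimodule S M N) (pure_tensor S M N x y) t =
    pure_tensor S M N x (rsmult N y t)"
proof (rule tensor_coset_eq[OF assms(1,2)])
  interpret N: bimodule S T N by fact
  interpret T: bimodule R T "tensor_bimodule S M N"
    by (rule bimodule_tensor_bimodule) fact+
  have yt: "rsmult N y t \<in> carrier N" using assms by (simp add: N.rsmult_closed)
  show "rsmult (tensor_bimodule S M N) (pure_tensor S M N x y) t \<in> carrier (tensor_bimodule S M N)"
    by (intro T.rsmult_closed pure_tensor_closed) fact+
  show "pure_tensor S M N x (rsmult N y t) \<in> carrier (tensor_bimodule S M N)"
    by (rule pure_tensor_closed[OF assms(4) yt])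
  show *: "frag_of (x, rsmult N y t) \<in> pure_tensor S M N x (rsmult N y t)"
    by (rule frag_of_in_pure_tensor[OF assms(1,2,4) yt])
  show "frag_of (x, rsmult N y t) \<in> rsmult (tensor_bimodule S M N) (pure_tensor S M N x y) t"
    using * frag_of_in_pure_tensor[OF assms(1,2,4,5)]
    by (auto simp: tensor_bimodule_def Let_def pure_tensor_def[of _ _ _ _ "rsmult N y t"]
        intro!: bexI[of _ "frag_of (x, y)"])
qed

text \<open>The universal property of the tensor product, as a means of telling pure tensors apart.
  A biadditive balanced \<open>b\<close> extends to a homomorphism on the free abelian group. This
  homomorphism kills the relators, hence the subgroup they generate, so it agrees on any two
  representatives of one coset.\<close>

lemma pure_tensor_eqD:
  assumes "bimodule R S M" "bimodule S T N" "abelian_group A"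
    and closed: "\<And>x y. \<lbrakk>x \<in> carrier M; y \<in> carrier N\<rbrakk> \<Longrightarrow> b x y \<in> carrier A"
    and add_left: "\<And>x x' y. \<lbrakk>x \<in> carrier M; x' \<in> carrier M; y \<in> carrier N\<rbrakk> \<Longrightarrow>
      b (x \<oplus>\<^bsub>M\<^esub> x') y = b x y \<oplus>\<^bsub>A\<^esub> b x' y"
    and add_right: "\<And>x y y'. \<lbrakk>x \<in> carrier M; y \<in> carrier N; y' \<in> carrier N\<rbrakk> \<Longrightarrow>
      b x (y \<oplus>\<^bsub>N\<^esub> y') = b x y \<oplus>\<^bsub>A\<^esub> b x y'"
    and balanced: "\<And>x s y. \<lbrakk>x \<in> carrier M; s \<in> carrier S; y \<in> carrier N\<rbrakk> \<Longrightarrow>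
      b (rsmult M x s) y = b x (lsmult N s y)"
    and eq: "pure_tensor S M N x y = pure_tensor S M N x' y'"
    and mem: "x \<in> carrier M" "x' \<in> carrier M" "y \<in> carrier N" "y' \<in> carrier N"
  shows "b x y = b x' y'"
proof -
  interpret M: bimodule R S M by fact
  interpret N: bimodule S T N by fact
  interpret A: abelian_group A by fact
  let ?F = "tensor_free M N"
  interpret F: comm_group ?F by (rule comm_group_tensor_free)
  have "(\<lambda>(x, y). b x y) ` (carrier M \<times> carrier N) \<subseteq> carrier (add_monoid A)"
    using closed by auto
  then obtain h where h: "h \<in> hom ?F (add_monoid A)"
    and h_pure: "\<And>p. p \<in> carrier M \<times> carrier N \<Longrightarrow> h (frag_of p) = (\<lambda>(x, y). b x y) p"
    unfolding tensor_free_def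
    by (rule comm_group.free_Abelian_group_universal[OF A.a_comm_group]) blast
  interpret h: group_hom ?F "add_monoid A" h
    by (intro group_hom.intro group_hom_axioms.intro F.group_axioms A.a_group h)
  have hcl: "h u \<in> carrier A" if "u \<in> carrier ?F" for u
    using h.hom_closed[OF that] by simp
  have hdiff: "h (u - v) = h u \<ominus>\<^bsub>A\<^esub> h v" if "u \<in> carrier ?F" "v \<in> carrier ?F" for u v
  proof -
    have "h (u - v) \<oplus>\<^bsub>A\<^esub> h v = h (u - v + v)"
      using h.hom_mult[OF diff_in_tensor_free[OF that] that(2)] by (simp add: tensor_free_def)
    then have "h (u - v) \<oplus>\<^bsub>A\<^esub> h v = h u" by simp
    then show ?thesis
      using hcl[OF that(1)] hcl[OF that(2)] hcl[OF diff_in_tensor_free[OF that]]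
      by (metis A.add.inv_solve_right A.minus_eq)
  qed
  \<comment> \<open>This is the shape \<open>a + c - a - c\<close> that the image of a biadditivity
    relator takes once sums are associated to the right.\<close>
  have cancel: "a \<oplus>\<^bsub>A\<^esub> (c \<oplus>\<^bsub>A\<^esub> (\<ominus>\<^bsub>A\<^esub> a \<oplus>\<^bsub>A\<^esub> \<ominus>\<^bsub>A\<^esub> c)) = \<zero>\<^bsub>A\<^esub>"
    if "a \<in> carrier A" "c \<in> carrier A" for a c
    using that A.r_neg[of "a \<oplus>\<^bsub>A\<^esub> c"] by (simp add: A.minus_add A.a_assoc)
  have "tensor_kernel S M N \<subseteq> kernel ?F (add_monoid A) h"
    unfolding tensor_kernel_def
  proof (rule F.generate_subgroup_incl[OF _ h.subgroup_kernel], rule subsetI)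
    fix d assume d: "d \<in> tensor_relators S M N"
    have "h d = \<zero>\<^bsub>A\<^esub>"
      using d unfolding tensor_relators_def
      by (auto simp: hdiff diff_in_tensor_free h_pure M.rsmult_closed N.lsmult_closed closed
          add_left add_right balanced A.minus_eq A.a_assoc A.r_neg cancel)
    with d tensor_relators_subset[OF assms(1,2)] show "d \<in> kernel ?F (add_monoid A) h"
      by (auto simp: kernel_def)
  qed
  moreover have "frag_of (x, y) \<in> tensor_kernel S M N #>\<^bsub>?F\<^esub> frag_of (x', y')"
    using frag_of_in_pure_tensor[OF assms(1,2) mem(1,3)] eq by (simp add: pure_tensor_def)
  then obtain k where "k \<in> tensor_kernel S M N" "frag_of (x, y) = k \<otimes>\<^bsub>?F\<^esub> frag_of (x', y')"
    by (auto simp: r_coset_def)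
  ultimately have "h (frag_of (x, y)) = h (frag_of (x', y'))"
    using mem by (auto simp: kernel_def hcl)
  then show ?thesis using mem by (simp add: h_pure)
qed

section \<open>Depth two and normality\<close>

text \<open>The isomorphism onto a summand of \<open>A^n\<close> is injective, so the images of
  \<open>X\<close> and \<open>Y\<close> differ in some coordinate. The actions on \<open>A^n\<close>
  are componentwise, so that coordinate commutes with both actions and serves as
  \<open>f\<close>.\<close>

lemma right_depth_two_separates:
  assumes "right_depth_two B A \<phi>"
  defines "T \<equiv> tensor_bimodule B (ring_bimodule (\<lambda>a. a) \<phi> A) (ring_bimodule \<phi> \<phi> A)"
  assumes "X \<in> carrier T" "Y \<in> carrier T" "X \<noteq> Y"
  obtains f where "f X \<noteq> f Y"
    and "\<And>Z. Z \<in> carrier T \<Longrightarrow> f Z \<in> carrier A"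
    and "\<And>a Z. \<lbrakk>a \<in> carrier A; Z \<in> carrier T\<rbrakk> \<Longrightarrow> f (lsmult T a Z) = a \<otimes>\<^bsub>A\<^esub> f Z"
    and "\<And>b Z. \<lbrakk>b \<in> carrier B; Z \<in> carrier T\<rbrakk> \<Longrightarrow> f (rsmult T Z b) = f Z \<otimes>\<^bsub>A\<^esub> \<phi> b"
proof -
  let ?N = "ring_bimodule (\<lambda>a. a) \<phi> A"
  obtain n U h where U: "direct_summand A B U (bimodule_power ?N n)"
    and h: "h \<in> bimodule_iso A B T (bimodule_power ?N n\<lparr>carrier := U\<rparr>)"
    using assms(1) unfolding right_depth_two_def iso_to_direct_summand_def T_def by blast
  have bij: "bij_betw h (carrier T) U"
    and l: "\<And>a Z. \<lbrakk>a \<in> carrier A; Z \<in> carrier T\<rbrakk> \<Longrightarrow>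
      h (lsmult T a Z) = (\<lambda>i\<in>{..<n}. a \<otimes>\<^bsub>A\<^esub> h Z i)"
    and r: "\<And>b Z. \<lbrakk>b \<in> carrier B; Z \<in> carrier T\<rbrakk> \<Longrightarrow>
      h (rsmult T Z b) = (\<lambda>i\<in>{..<n}. h Z i \<otimes>\<^bsub>A\<^esub> \<phi> b)"
    using h by (auto simp: bimodule_iso_def iso_def bimodule_power_def ring_bimodule_def)
  have "U \<subseteq> carrier (bimodule_power ?N n)"
    using U subgroup.subset by (fastforce simp: direct_summand_def subbimodule_def)
  then have cl: "h Z \<in> {..<n} \<rightarrow>\<^sub>E carrier A" if "Z \<in> carrier T" for Z
    using bij_betwE[OF bij] that by (auto simp: bimodule_power_def ring_bimodule_def)
  have "h X \<noteq> h Y" using bij assms(3-5) by (auto simp: bij_betw_def inj_on_def)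
  \<comment> \<open>Members of the power are undefined off the indices below \<open>n\<close>, so
    two different ones differ at an index below \<open>n\<close>.\<close>
  then obtain i where "i < n" "h X i \<noteq> h Y i"
    using PiE_ext[OF cl[OF assms(3)] cl[OF assms(4)]] by blast
  with l r cl show thesis by (intro that[of "\<lambda>Z. h Z i"]) (auto simp: PiE_iff)
qed

section \<open>Computations in the complex group algebra\<close>

text \<open>No group occurs as a parameter, so for \<open>g\<close> in a subgroup the same function
  lies in both group algebras.\<close>

definition basis_vector :: "'g \<Rightarrow> 'g \<Rightarrow> complex" where
  "basis_vector g = (\<lambda>x. if x = g then 1 else 0)"

lemma basis_vector_closed [simp]:
  "g \<in> carrier G \<Longrightarrow> basis_vector g \<in> carrier (group_algebra G)"
  by (auto simp: basis_vector_def group_algebra_def)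

lemma finite_group_algebra_carrier:
  assumes "finite (carrier G)"
  shows "f \<in> carrier (group_algebra G) \<longleftrightarrow> (\<forall>x. x \<notin> carrier G \<longrightarrow> f x = 0)"
  using assms by (auto simp: group_algebra_def intro: finite_subset)

lemma mult_basis_vector:
  assumes "group G" "f \<in> carrier (group_algebra G)" "g \<in> carrier G" "x \<in> carrier G"
  shows "(f \<otimes>\<^bsub>group_algebra G\<^esub> basis_vector g) x = f (x \<otimes>\<^bsub>G\<^esub> inv\<^bsub>G\<^esub> g)"
proof -
  interpret group G by fact
  let ?X = "{y. f y \<noteq> 0}"
  have X: "finite ?X" "?X \<subseteq> carrier G" using assms(2) by (auto simp: group_algebra_def)
  have "(f \<otimes>\<^bsub>group_algebra G\<^esub> basis_vector g) x =
      (\<Sum>y\<in>?X. \<Sum>z\<in>{g}. if y \<otimes>\<^bsub>G\<^esub> z = x then f y * basis_vector g z else 0)"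
    by (rule group_algebra_mult) (use X in \<open>auto simp: basis_vector_def\<close>)
  also have "\<dots> = (\<Sum>y\<in>?X. if y = x \<otimes>\<^bsub>G\<^esub> inv\<^bsub>G\<^esub> g then f y else 0)"
    using X assms(3,4) by (intro sum.cong) (auto simp: basis_vector_def m_assoc)
  also have "\<dots> = f (x \<otimes>\<^bsub>G\<^esub> inv\<^bsub>G\<^esub> g)" using X(1) by simp
  finally show ?thesis .
qed

lemma basis_vector_mult:
  "basis_vector g \<otimes>\<^bsub>group_algebra G\<^esub> basis_vector k = basis_vector (g \<otimes>\<^bsub>G\<^esub> k)"
proof
  fix x
  have "(basis_vector g \<otimes>\<^bsub>group_algebra G\<^esub> basis_vector k) x =
      (\<Sum>y\<in>{g}. \<Sum>z\<in>{k}. if y \<otimes>\<^bsub>G\<^esub> z = x then basis_vector g y * basis_vector k z else 0)"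
    by (rule group_algebra_mult) (auto simp: basis_vector_def)
  then show "(basis_vector g \<otimes>\<^bsub>group_algebra G\<^esub> basis_vector k) x = basis_vector (g \<otimes>\<^bsub>G\<^esub> k) x"
    by (auto simp: basis_vector_def)
qed

text \<open>The element \<open>t\<close> of the overview: the order of \<open>G\<close> times the
  idempotent of the trivial representation.\<close>

definition group_sum :: "('g, 'a) monoid_scheme \<Rightarrow> 'g \<Rightarrow> complex" where
  "group_sum G = (\<lambda>x. if x \<in> carrier G then 1 else 0)"

text \<open>For each \<open>z\<close> exactly one \<open>y\<close> in \<open>G\<close> solves
  \<open>y z = x\<close>, so every coefficient of \<open>a\<close> is counted once. The value is the
  augmentation of \<open>a\<close> and does not depend on \<open>x\<close>: \<open>t a\<close> is a
  multiple of \<open>t\<close>.\<close>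

lemma group_sum_mult:
  assumes "group G" "finite (carrier G)" "a \<in> carrier (group_algebra G)" "x \<in> carrier G"
  shows "(group_sum G \<otimes>\<^bsub>group_algebra G\<^esub> a) x = (\<Sum>z\<in>carrier G. a z)"
proof -
  interpret group G by fact
  have "(group_sum G \<otimes>\<^bsub>group_algebra G\<^esub> a) x =
      (\<Sum>y\<in>carrier G. \<Sum>z\<in>carrier G. if y \<otimes>\<^bsub>G\<^esub> z = x then group_sum G y * a z else 0)"
    using assms by (intro group_algebra_mult) (auto simp: group_sum_def group_algebra_def)
  also have "\<dots> = (\<Sum>z\<in>carrier G. \<Sum>y\<in>carrier G. if y = x \<otimes>\<^bsub>G\<^esub> inv\<^bsub>G\<^esub> z then a z else 0)"
    using assms(4) by (subst sum.swap) (auto simp: group_sum_def m_assoc intro!: sum.cong)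
  also have "\<dots> = (\<Sum>z\<in>carrier G. a z)"
    using assms by (intro sum.cong) auto
  finally show ?thesis .
qed

text \<open>Right multiplication by \<open>k\<close> translates the argument within
  \<open>G\<close>, and \<open>t a\<close> is constant on \<open>G\<close>.\<close>

lemma group_sum_mult_basis_vector:
  assumes "group G" "finite (carrier G)" "a \<in> carrier (group_algebra G)" "k \<in> carrier G"
  shows "group_sum G \<otimes>\<^bsub>group_algebra G\<^esub> a \<otimes>\<^bsub>group_algebra G\<^esub> basis_vector k =
    group_sum G \<otimes>\<^bsub>group_algebra G\<^esub> a" (is "?l = ?r")
proof
  interpret group G by fact
  interpret A: ring "group_algebra G" by (rule ring_group_algebra) fact
  fix x
  have r: "?r \<in> carrier (group_algebra G)"
    using assms by (intro A.m_closed) (auto simp: finite_group_algebra_carrier group_sum_def)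
  then have l: "?l \<in> carrier (group_algebra G)" using assms(4) by simp
  show "?l x = ?r x"
  proof (cases "x \<in> carrier G")
    case True
    with r assms show ?thesis by (simp add: mult_basis_vector group_sum_mult)
  next
    \<comment> \<open>Elements are functions on the whole type, so equality has to be checked off
      \<open>G\<close> too, where both sides vanish.\<close>
    case False
    with l r assms(2) show ?thesis by (simp add: finite_group_algebra_carrier)
  qed
qed

text \<open>On the group algebra of \<open>G\<close> this is the projection onto that of
  \<open>H\<close> along the span of the elements outside \<open>H\<close>.\<close>

definition restrict_to :: "'g set \<Rightarrow> ('g \<Rightarrow> complex) \<Rightarrow> 'g \<Rightarrow> complex" where
  "restrict_to H x = (\<lambda>p. if p \<in> H then x p else 0)"

text \<open>Right multiplication by an element of \<open>H\<close> maps both \<open>H\<close> and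
  its complement in \<open>G\<close> into themselves, so the projection is right linear over the
  algebra of \<open>H\<close>. This makes the map sending \<open>(x, y)\<close> to
  \<open>restrict_to H x\<close> times \<open>y\<close> balanced.\<close>

lemma restrict_to_mult:
  assumes "group G" "finite (carrier G)" "subgroup H G"
    and "x \<in> carrier (group_algebra G)" "s \<in> carrier (group_algebra (G\<lparr>carrier := H\<rparr>))"
  shows "restrict_to H (x \<otimes>\<^bsub>group_algebra G\<^esub> s) = restrict_to H x \<otimes>\<^bsub>group_algebra G\<^esub> s"
proof
  interpret group G by fact
  interpret H: subgroup H G by fact
  fix p
  have sH: "z \<in> H" if "s z \<noteq> 0" for z using that assms(5) by (auto simp: group_algebra_def)
  have m: "(f \<otimes>\<^bsub>group_algebra G\<^esub> s) p =
      (\<Sum>y\<in>carrier G. \<Sum>z\<in>H. if y \<otimes>\<^bsub>G\<^esub> z = p then f y * s z else 0)"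
    if "f \<in> carrier (group_algebra G)" for f
    using that assms(2) sH finite_subset[OF H.subset assms(2)]
    by (intro group_algebra_mult) (auto simp: group_algebra_def)
  have iff: "y \<otimes>\<^bsub>G\<^esub> z \<in> H \<longleftrightarrow> y \<in> H" if "y \<in> carrier G" "z \<in> H" for y z
  proof
    assume "y \<otimes>\<^bsub>G\<^esub> z \<in> H"
    then have "y \<otimes>\<^bsub>G\<^esub> z \<otimes>\<^bsub>G\<^esub> inv\<^bsub>G\<^esub> z \<in> H" using that by blast
    then show "y \<in> H" using that by (simp add: m_assoc)
  qed (use that in simp)
  have rx: "restrict_to H x \<in> carrier (group_algebra G)"
    using assms(2,4) by (auto simp: finite_group_algebra_carrier restrict_to_def)
  show "restrict_to H (x \<otimes>\<^bsub>group_algebra G\<^esub> s) p = (restrict_to H x \<otimes>\<^bsub>group_algebra G\<^esub> s) p"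
    unfolding m[OF rx] by (auto simp: restrict_to_def m[OF assms(4)] iff intro!: sum.cong sum.neutral)
qed

section \<open>From depth two to normality\<close>

theorem theorem3p1:
  fixes G :: "('g, 'a) monoid_scheme" and H :: "'g set"
  assumes "group G" and "finite (carrier G)" and "subgroup H G"
    and "depth_two (group_algebra (G\<lparr>carrier := H\<rparr>)) (group_algebra G) (\<lambda>f. f)"
  shows "H \<lhd> G"
proof -
  interpret group G by fact
  interpret H: subgroup H G by fact
  let ?A = "group_algebra G" and ?B = "group_algebra (G\<lparr>carrier := H\<rparr>)"
  interpret A: ring ?A by (rule ring_group_algebra) fact
  interpret B: ring ?B by (intro ring_group_algebra H.subgroup_is_group is_group)
  interpret BA: ring_hom_ring ?B ?A "\<lambda>f. f" by (rule ring_hom_group_algebra) fact+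
  \<comment> \<open>The inclusion is the identity function, so a single term serves as both tensor
    factors: as an \<open>?A\<close>-\<open>?B\<close>-bimodule on the left and as a
    \<open>?B\<close>-\<open>?B\<close>-bimodule on the right.\<close>
  let ?M = "ring_bimodule (\<lambda>a. a) (\<lambda>f. f) ?A :: ('g \<Rightarrow> complex, 'g \<Rightarrow> complex, _) bimodule"
  let ?T = "tensor_bimodule ?B ?M ?M"
  let ?p = "pure_tensor ?B ?M ?M"
  have M: "bimodule ?A ?B ?M" and N: "bimodule ?B ?B ?M"
    by (intro bimodule_ring_bimodule A.ring_axioms B.ring_axioms BA.homh; simp add: ring_hom_def)+
  note MN = M N
  have [simp]: "carrier ?M = carrier ?A" "lsmult ?M = (\<otimes>\<^bsub>?A\<^esub>)" "rsmult ?M = (\<otimes>\<^bsub>?A\<^esub>)"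
    "add ?M = add ?A"
    by (simp_all add: ring_bimodule_def fun_eq_iff)
  have restrict: "restrict_to H x \<in> carrier ?A" if "x \<in> carrier ?A" for x
    using that assms(2) by (auto simp: finite_group_algebra_carrier restrict_to_def)
  have t: "group_sum G \<in> carrier ?A"
    using assms(2) by (auto simp: finite_group_algebra_carrier group_sum_def)
  have "g \<otimes>\<^bsub>G\<^esub> h \<otimes>\<^bsub>G\<^esub> inv\<^bsub>G\<^esub> g \<in> H" if g: "g \<in> carrier G" and h: "h \<in> H" for g h
  proof -
    \<comment> \<open>The coset equation \<open>H g k = H g\<close> yields that \<open>g\<close>
      times the inverse of \<open>k\<close> times the inverse of \<open>g\<close> lies in
      \<open>H\<close>; taking \<open>k\<close> inverse to \<open>h\<close> makes this the required
      conjugate of \<open>h\<close>.\<close>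
    define k where "k = inv\<^bsub>G\<^esub> h"
    have k: "k \<in> H" "k \<in> carrier G" "inv\<^bsub>G\<^esub> k = h" using h by (auto simp: k_def)
    have dg: "basis_vector g \<in> carrier ?A" "basis_vector (g \<otimes>\<^bsub>G\<^esub> k) \<in> carrier ?A"
      and dk: "basis_vector k \<in> carrier ?B"
      using g k by simp_all
    have mem: "?p x y \<in> carrier ?T" if "x \<in> carrier ?A" "y \<in> carrier ?A" for x y
      using pure_tensor_closed[of _ ?M _ ?M ?B] that by simp
    have "?p (group_sum G) (basis_vector g) = ?p (group_sum G) (basis_vector (g \<otimes>\<^bsub>G\<^esub> k))"
    proof (rule ccontr)
      assume ne: "?p (group_sum G) (basis_vector g) \<noteq> ?p (group_sum G) (basis_vector (g \<otimes>\<^bsub>G\<^esub> k))"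
      obtain f where f: "f (?p (group_sum G) (basis_vector g)) \<noteq>
          f (?p (group_sum G) (basis_vector (g \<otimes>\<^bsub>G\<^esub> k)))"
        and cl: "\<And>Z. Z \<in> carrier ?T \<Longrightarrow> f Z \<in> carrier ?A"
        and fl: "\<And>a Z. \<lbrakk>a \<in> carrier ?A; Z \<in> carrier ?T\<rbrakk> \<Longrightarrow> f (lsmult ?T a Z) = a \<otimes>\<^bsub>?A\<^esub> f Z"
        and fr: "\<And>b Z. \<lbrakk>b \<in> carrier ?B; Z \<in> carrier ?T\<rbrakk> \<Longrightarrow> f (rsmult ?T Z b) = f Z \<otimes>\<^bsub>?A\<^esub> b"
        using right_depth_two_separates[of ?B ?A "\<lambda>f. f", OF _ _ _ ne] assms(4) mem[OF t] dg
        unfolding depth_two_def by blast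
      let ?a = "f (?p \<one>\<^bsub>?A\<^esub> (basis_vector g))"
      have a: "?a \<in> carrier ?A" using cl mem dg by simp
      \<comment> \<open>Left linearity applied to \<open>t \<otimes> g = t (1 \<otimes> g)\<close>
        moves \<open>t\<close> outside \<open>f\<close>.\<close>
      have 1: "f (?p (group_sum G) (basis_vector g)) = group_sum G \<otimes>\<^bsub>?A\<^esub> ?a"
        using fl[OF t mem[OF A.one_closed dg(1)]] lsmult_pure_tensor[OF MN t, of "\<one>\<^bsub>?A\<^esub>"] t dg(1)
        by simp
      \<comment> \<open>Right linearity applied to
        \<open>t \<otimes> g k = (t \<otimes> g) k\<close> moves \<open>k\<close> outside
        \<open>f\<close>, where \<open>t\<close> absorbs it.\<close>
      have "f (?p (group_sum G) (basis_vector (g \<otimes>\<^bsub>G\<^esub> k))) =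
          f (?p (group_sum G) (basis_vector g)) \<otimes>\<^bsub>?A\<^esub> basis_vector k"
        using fr[OF dk mem[OF t dg(1)]] rsmult_pure_tensor[OF MN dk, of "group_sum G"] t dg(1) g k
        by (simp add: basis_vector_mult)
      also have "\<dots> = f (?p (group_sum G) (basis_vector g))"
        unfolding 1 by (rule group_sum_mult_basis_vector) (use a k assms in auto)
      finally show False using f by simp
    qed
    \<comment> \<open>Restricting \<open>t\<close> to \<open>H\<close> gives the sum over
      \<open>H\<close>, so the two sides are the indicator functions of the right cosets
      \<open>H g\<close> and \<open>H g k\<close>.\<close>
    then have "restrict_to H (group_sum G) \<otimes>\<^bsub>?A\<^esub> basis_vector g =
        restrict_to H (group_sum G) \<otimes>\<^bsub>?A\<^esub> basis_vector (g \<otimes>\<^bsub>G\<^esub> k)"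
    proof (rule pure_tensor_eqD[OF MN A.abelian_group_axioms,
          where b = "\<lambda>x y. restrict_to H x \<otimes>\<^bsub>?A\<^esub> y", rotated 4])
      fix x x' y assume "x \<in> carrier ?M" "x' \<in> carrier ?M" "y \<in> carrier ?M"
      moreover have "restrict_to H (x \<oplus>\<^bsub>?A\<^esub> x') = restrict_to H x \<oplus>\<^bsub>?A\<^esub> restrict_to H x'"
        by (auto simp: restrict_to_def group_algebra_def)
      ultimately show "restrict_to H (x \<oplus>\<^bsub>?M\<^esub> x') \<otimes>\<^bsub>?A\<^esub> y =
          restrict_to H x \<otimes>\<^bsub>?A\<^esub> y \<oplus>\<^bsub>?A\<^esub> restrict_to H x' \<otimes>\<^bsub>?A\<^esub> y"
        by (simp add: restrict A.l_distr)
    next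
      fix x s y assume a: "x \<in> carrier ?M" "s \<in> carrier ?B" "y \<in> carrier ?M"
      then show "restrict_to H (rsmult ?M x s) \<otimes>\<^bsub>?A\<^esub> y = restrict_to H x \<otimes>\<^bsub>?A\<^esub> lsmult ?M s y"
        using BA.hom_closed[OF a(2)]
        by (simp add: restrict_to_mult[OF assms(1-3)] restrict A.m_assoc)
    qed (use t dg restrict in \<open>auto simp: A.r_distr\<close>)
    \<comment> \<open>Both indicator functions are evaluated at \<open>g\<close>. The left value is
      1 because the identity lies in \<open>H\<close>, which forces the argument on the right into
      \<open>H\<close>.\<close>
    then have "restrict_to H (group_sum G) \<one>\<^bsub>G\<^esub> = restrict_to H (group_sum G) (g \<otimes>\<^bsub>G\<^esub> inv\<^bsub>G\<^esub> (g \<otimes>\<^bsub>G\<^esub> k))"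
      using mult_basis_vector[OF is_group restrict[OF t] _ g, of g]
        mult_basis_vector[OF is_group restrict[OF t] _ g, of "g \<otimes>\<^bsub>G\<^esub> k"] g k
      by simp
    then have "g \<otimes>\<^bsub>G\<^esub> inv\<^bsub>G\<^esub> (g \<otimes>\<^bsub>G\<^esub> k) \<in> H"
      by (auto simp: restrict_to_def group_sum_def split: if_splits)
    then show ?thesis using g k H.mem_carrier[OF h] by (simp add: inv_mult_group m_assoc)
  qed
  then show ?thesis using H.subgroup_axioms by (simp add: normal_inv_iff)
qed

end
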